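(* Let $A\in\mathcal{M}_n(\mathbb{C})$ be a diagonal matrix with $k$-th diagonal entry $a_k\in\mathbb{C}$ for $k=1,\ldots,n$, and let $B=hJ_m$, where $h\in\mathbb{C}$ and $J_m$ is the $m\times m$ matrix with all entries equal to $1$. Suppose that there exists no index $k\in\{1,\ldots,n\}$ such that $a_k=0$ or $a_k=-mh$. For $i=1,\ldots,n$ let $C_i\in\mathcal{M}_n(\mathbb{C})$ be the matrix with entry $1$ in position $(i,i)$ and $0$ elsewhere, and put $$A_1=A,\quad A_2=C_1,\ \ldots,\ A_{n+1}=C_n,$$ $$B_1=I_m^{\otimes n},\qquad B_r=\left(I_m^{\otimes(r-2)}\otimes B\otimes I_m^{\otimes(n-r+1)}\right)^T\quad\text{for } r=2,\ldots,n+1.$$ Let $C\in\mathcal{M}_{n\times m^n}(\mathbb{C})$. Then the equation $$\sum_{i=1}^{n+1}A_iXB_i=C$$ admits a unique solution $X\in\mathcal{M}_{n\times m^n}(\mathbb{C})$.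
   Context: $n,m$ are positive integers. $\otimes$ denotes the Kronecker product of matrices and $I_m^{\otimes r}$ is the $r$-fold Kronecker power of the identity matrix $I_m$, with $I_m^{\otimes 0}=1$. *)

theory Defs
  imports Complex_Main "Jordan_Normal_Form.Matrix"
begin

definition kronecker_mat :: "'a :: times mat \<Rightarrow> 'a mat \<Rightarrow> 'a mat" (infixl \<open>\<otimes>\<^sub>K\<close> 70) where
  "A \<otimes>\<^sub>K B = mat (dim_row A * dim_row B) (dim_col A * dim_col B)
     (\<lambda>(i, j). A $$ (i div dim_row B, j div dim_col B) * B $$ (i mod dim_row B, j mod dim_col B))"

text \<open>The zeroth Kronecker power is the $1 \times 1$ identity matrix, i.e. the scalar 1.\<close>

fun kronecker_pow :: "'a :: semiring_1 mat \<Rightarrow> nat \<Rightarrow> 'a mat" where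
  "kronecker_pow A 0 = 1\<^sub>m 1"
| "kronecker_pow A (Suc r) = kronecker_pow A r \<otimes>\<^sub>K A"

definition all_ones_mat :: "nat \<Rightarrow> 'a :: one mat" where
  "all_ones_mat m = mat m m (\<lambda>_. 1)"

text \<open>Rows and columns of \<^typ>\<open>'a mat\<close> are indexed from 0; here the position \<open>i\<close> is counted from 1.\<close>

definition diag_unit_mat :: "nat \<Rightarrow> nat \<Rightarrow> 'a :: {zero, one} mat" where
  "diag_unit_mat n i = mat n n (\<lambda>(p, q). if p + 1 = i \<and> q + 1 = i then 1 else 0)"

text \<open>Type \<^typ>\<open>'a mat\<close> has no additive unit independent of the dimensions, so \<^const>\<open>sum\<close> is not
  available; this is the analogue of \<^const>\<open>finsum_vec\<close>.\<close>

definition finsum_mat ::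
  "'a :: monoid_add itself \<Rightarrow> nat \<Rightarrow> nat \<Rightarrow> ('c \<Rightarrow> 'a mat) \<Rightarrow> 'c set \<Rightarrow> 'a mat" where
  "finsum_mat ty nr nc = finprod (monoid_mat ty nr nc)"

end

theory Submission
  imports Defs
begin

text \<open>The matrix \<open>C\<^sub>p\<close> selects row \<open>p\<close>, so the equation decouples into one linear system
  \<open>(a\<^sub>p I + D\<^sub>p) x\<^sub>p = c\<^sub>p\<close> per row, where \<open>D\<^sub>p = I \<otimes> B \<otimes> I\<close>. Since \<open>B\<^sup>2 = m h B\<close>, also
  \<open>D\<^sub>p\<^sup>2 = m h D\<^sub>p\<close>; hence \<open>a\<^sub>p I + D\<^sub>p\<close> has the explicit inverse
  \<open>(I - D\<^sub>p / (a\<^sub>p + m h)) / a\<^sub>p\<close>, which exists because \<open>a\<^sub>p \<noteq> 0\<close> and \<open>a\<^sub>p \<noteq> - m h\<close>.\<close>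

section \<open>Finite sums: entries of matrix sums, and sums over split indices\<close>

lemma finsum_mat_closed:
  assumes "f \<in> F \<rightarrow> carrier_mat nr nc"
  shows "finsum_mat TYPE('a :: comm_monoid_add) nr nc f F \<in> carrier_mat nr nc"
  using comm_monoid.finprod_closed[OF comm_monoid_mat, of f F nr nc] assms
  by (simp add: finsum_mat_def monoid_mat_def)

text \<open>Induction on \<open>F\<close>: \<open>finsum_mat\<close> is a \<open>finprod\<close> in
  \<open>monoid_mat\<close>, whose insertion rule applies only when the summands lie in the
  carrier.\<close>

lemma index_finsum_mat:
  assumes "finite F" and "i < nr" "j < nc" and "f \<in> F \<rightarrow> carrier_mat nr nc"
  shows "finsum_mat TYPE('a :: comm_monoid_add) nr nc f F $$ (i, j) = (\<Sum>x\<in>F. f x $$ (i, j))"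
  using assms(1,4)
proof (induction F)
  case empty
  show ?case
    using assms(2,3) comm_monoid.finprod_empty[OF comm_monoid_mat, of nr nc f]
    by (simp add: finsum_mat_def monoid_mat_def)
next
  case (insert x F)
  then have f: "f \<in> F \<rightarrow> carrier_mat nr nc" "f x \<in> carrier_mat nr nc"
    by auto
  have "finsum_mat TYPE('a) nr nc f (insert x F) = f x + finsum_mat TYPE('a) nr nc f F"
    using comm_monoid.finprod_insert[OF comm_monoid_mat, of F x f nr nc] insert.hyps f
    by (simp add: finsum_mat_def monoid_mat_def)
  then show ?case
    using insert f assms(2,3) finsum_mat_closed[OF f(1)] by auto
qed

text \<open>Writing k = i * s + j makes k run through all pairs (i, j). The induction splits off the
  last block of s indices, on which \<open>k div s\<close> is constant. This is the index arithmetic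
  behind the mixed-product rule.\<close>

lemma sum_div_mod_product:
  fixes f g :: "nat \<Rightarrow> 'a :: comm_semiring_0"
  shows "(\<Sum>k<r * s. f (k div s) * g (k mod s)) = (\<Sum>i<r. f i) * (\<Sum>j<s. g j)"
proof (induction r)
  case 0
  show ?case by simp
next
  case (Suc r)
  have "(\<Sum>k<Suc r * s. f (k div s) * g (k mod s)) =
      (\<Sum>k<r * s. f (k div s) * g (k mod s)) +
      (\<Sum>k\<in>{r * s..<r * s + s}. f (k div s) * g (k mod s))"
    by (simp add: lessThan_atLeast0 sum.atLeastLessThan_concat add.commute)
  also have "(\<Sum>k\<in>{r * s..<r * s + s}. f (k div s) * g (k mod s)) =
      (\<Sum>j<s. f ((j + r * s) div s) * g ((j + r * s) mod s))"
    using sum.shift_bounds_nat_ivl[of "\<lambda>k. f (k div s) * g (k mod s)" 0 "r * s" s]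
    by (simp add: lessThan_atLeast0 add.commute)
  also have "\<dots> = f r * (\<Sum>j<s. g j)"
    by (simp add: sum_distrib_left)
  finally show ?case
    by (simp add: Suc.IH algebra_simps)
qed

section \<open>Kronecker products\<close>

lemma kronecker_mat_carrier:
  "A \<in> carrier_mat r c \<Longrightarrow> B \<in> carrier_mat s d \<Longrightarrow> A \<otimes>\<^sub>K B \<in> carrier_mat (r * s) (c * d)"
  by (auto simp: kronecker_mat_def)

lemma div_less_of_less_mult: "i < r * s \<Longrightarrow> i div s < (r :: nat)"
  by (simp add: less_mult_imp_div_less)

lemma mod_less_of_less_mult: "i < r * s \<Longrightarrow> i mod s < (s :: nat)"
  by (cases "s = 0") auto

text \<open>The mixed-product rule: the inner summation index q < k * l splits into
  \<open>q div l\<close> and \<open>q mod l\<close>, and the summand is a product of a factor in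
  each, so the sum factors.\<close>

lemma kronecker_mat_mult:
  fixes A B C D :: "'a :: comm_semiring_0 mat"
  assumes "A \<in> carrier_mat r k" "B \<in> carrier_mat s l" "C \<in> carrier_mat k c" "D \<in> carrier_mat l d"
  shows "(A \<otimes>\<^sub>K B) * (C \<otimes>\<^sub>K D) = (A * C) \<otimes>\<^sub>K (B * D)"
proof (rule eq_matI)
  fix i j
  assume "i < dim_row ((A * C) \<otimes>\<^sub>K (B * D))" "j < dim_col ((A * C) \<otimes>\<^sub>K (B * D))"
  then have ij: "i < r * s" "j < c * d"
    using assms by (auto simp: kronecker_mat_def)
  note bounds = ij[THEN div_less_of_less_mult] ij[THEN mod_less_of_less_mult]
  have "((A \<otimes>\<^sub>K B) * (C \<otimes>\<^sub>K D)) $$ (i, j) =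
      (\<Sum>q<k * l. (A $$ (i div s, q div l) * C $$ (q div l, j div d)) *
        (B $$ (i mod s, q mod l) * D $$ (q mod l, j mod d)))"
    using assms ij
    by (auto simp: kronecker_mat_def scalar_prod_def lessThan_atLeast0 ac_simps intro!: sum.cong)
  also have "\<dots> = (\<Sum>p<k. A $$ (i div s, p) * C $$ (p, j div d)) *
      (\<Sum>q<l. B $$ (i mod s, q) * D $$ (q, j mod d))"
    by (rule sum_div_mod_product)
  also have "\<dots> = ((A * C) \<otimes>\<^sub>K (B * D)) $$ (i, j)"
    using assms ij bounds by (auto simp: kronecker_mat_def scalar_prod_def lessThan_atLeast0)
  finally show "((A \<otimes>\<^sub>K B) * (C \<otimes>\<^sub>K D)) $$ (i, j) = ((A * C) \<otimes>\<^sub>K (B * D)) $$ (i, j)" .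
qed (use assms in \<open>auto simp: kronecker_mat_def\<close>)

lemma kronecker_mat_smult_left:
  fixes A B :: "'a :: comm_semiring_0 mat"
  shows "(c \<cdot>\<^sub>m A) \<otimes>\<^sub>K B = c \<cdot>\<^sub>m (A \<otimes>\<^sub>K B)"
  by (rule eq_matI)
    (auto simp: kronecker_mat_def ac_simps div_less_of_less_mult)

lemma kronecker_mat_smult_right:
  fixes A B :: "'a :: comm_semiring_0 mat"
  shows "A \<otimes>\<^sub>K (c \<cdot>\<^sub>m B) = c \<cdot>\<^sub>m (A \<otimes>\<^sub>K B)"
  by (rule eq_matI)
    (auto simp: kronecker_mat_def ac_simps mod_less_of_less_mult)

text \<open>An index is determined by its quotient and remainder modulo s, so the product of two
  Kronecker deltas is again a Kronecker delta.\<close>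

lemma kronecker_mat_one: "1\<^sub>m r \<otimes>\<^sub>K 1\<^sub>m s = (1\<^sub>m (r * s) :: 'a :: semiring_1 mat)"
proof (rule eq_matI)
  fix i j
  assume "i < dim_row (1\<^sub>m (r * s) :: 'a mat)" "j < dim_col (1\<^sub>m (r * s) :: 'a mat)"
  then have ij: "i < r * s" "j < r * s"
    by auto
  have "i = j \<longleftrightarrow> i div s = j div s \<and> i mod s = j mod s"
    by (metis div_mult_mod_eq)
  then show "(1\<^sub>m r \<otimes>\<^sub>K 1\<^sub>m s) $$ (i, j) = (1\<^sub>m (r * s) :: 'a mat) $$ (i, j)"
    using ij ij[THEN div_less_of_less_mult] ij[THEN mod_less_of_less_mult]
    by (auto simp: kronecker_mat_def)
qed (auto simp: kronecker_mat_def)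

lemma kronecker_pow_one: "kronecker_pow (1\<^sub>m m) r = 1\<^sub>m (m ^ r)"
  by (induction r) (simp_all add: kronecker_mat_one mult.commute)

text \<open>Two uses of the mixed-product rule reduce the square to \<open>B * B\<close> between
  identities; the scalar then moves out of both Kronecker products.\<close>

lemma kronecker_one_mat_one_square:
  fixes B :: "'a :: comm_semiring_1 mat"
  assumes B: "B \<in> carrier_mat m m" and sq: "B * B = \<mu> \<cdot>\<^sub>m B"
  shows "(1\<^sub>m r \<otimes>\<^sub>K B \<otimes>\<^sub>K 1\<^sub>m s) * (1\<^sub>m r \<otimes>\<^sub>K B \<otimes>\<^sub>K 1\<^sub>m s) = \<mu> \<cdot>\<^sub>m (1\<^sub>m r \<otimes>\<^sub>K B \<otimes>\<^sub>K 1\<^sub>m s)"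
proof -
  have "1\<^sub>m r \<otimes>\<^sub>K B \<in> carrier_mat (r * m) (r * m)"
    using B by (intro kronecker_mat_carrier) auto
  then have "(1\<^sub>m r \<otimes>\<^sub>K B \<otimes>\<^sub>K 1\<^sub>m s) * (1\<^sub>m r \<otimes>\<^sub>K B \<otimes>\<^sub>K 1\<^sub>m s) =
      ((1\<^sub>m r \<otimes>\<^sub>K B) * (1\<^sub>m r \<otimes>\<^sub>K B)) \<otimes>\<^sub>K (1\<^sub>m s * 1\<^sub>m s)"
    by (intro kronecker_mat_mult) auto
  also have "(1\<^sub>m r \<otimes>\<^sub>K B) * (1\<^sub>m r \<otimes>\<^sub>K B) = (1\<^sub>m r * 1\<^sub>m r) \<otimes>\<^sub>K (B * B)"
    using B by (intro kronecker_mat_mult) auto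
  finally show ?thesis
    by (simp add: sq kronecker_mat_smult_left kronecker_mat_smult_right)
qed

section \<open>Linear systems whose matrix is a shift of some D with D * D a multiple of D\<close>

lemma shifted_quasi_idempotent_solve:
  fixes D :: "'a :: field mat"
  assumes D: "D \<in> carrier_mat N N" and sq: "D * D = \<mu> \<cdot>\<^sub>m D"
    and a: "a \<noteq> 0" "a + \<mu> \<noteq> 0"
    and x: "x \<in> carrier_vec N" and c: "c \<in> carrier_vec N"
  shows "a \<cdot>\<^sub>v x + D *\<^sub>v x = c \<longleftrightarrow> x = (1 / a) \<cdot>\<^sub>v (c - (1 / (a + \<mu>)) \<cdot>\<^sub>v (D *\<^sub>v c))"
proof -
  have DD: "D *\<^sub>v (D *\<^sub>v v) = \<mu> \<cdot>\<^sub>v (D *\<^sub>v v)" if "v \<in> carrier_vec N" for v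
  proof -
    have "D *\<^sub>v (D *\<^sub>v v) = (D * D) *\<^sub>v v"
      using D that by (simp add: assoc_mult_mat_vec)
    also have "\<dots> = \<mu> \<cdot>\<^sub>v (D *\<^sub>v v)"
      using D that by (simp add: sq) (auto intro!: eq_vecI simp: scalar_prod_def sum_distrib_left ac_simps)
    finally show ?thesis .
  qed
  have Dx: "D *\<^sub>v x \<in> carrier_vec N" and Dc: "D *\<^sub>v c \<in> carrier_vec N"
    using D x c by auto
  show ?thesis
  proof
    assume eq: "a \<cdot>\<^sub>v x + D *\<^sub>v x = c"
    \<comment> \<open>Applying D to the equation and using \<open>DD\<close> makes D c the multiple
      a + \<mu> of D x, so the unknown D x can be eliminated from the equation.\<close>
    have "D *\<^sub>v c = a \<cdot>\<^sub>v (D *\<^sub>v x) + \<mu> \<cdot>\<^sub>v (D *\<^sub>v x)"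
      unfolding eq[symmetric] using D x Dx
      by (simp add: mult_add_distrib_mat_vec[OF D] mult_mat_vec[OF D] DD)
    then have "D *\<^sub>v c = (a + \<mu>) \<cdot>\<^sub>v (D *\<^sub>v x)"
      by (simp add: add_smult_distrib_vec)
    then have "c - (1 / (a + \<mu>)) \<cdot>\<^sub>v (D *\<^sub>v c) = a \<cdot>\<^sub>v x"
      unfolding eq[symmetric] using D x Dx a by (intro eq_vecI) auto
    then show "x = (1 / a) \<cdot>\<^sub>v (c - (1 / (a + \<mu>)) \<cdot>\<^sub>v (D *\<^sub>v c))"
      using a by (simp add: smult_smult_assoc)
  next
    assume eq: "x = (1 / a) \<cdot>\<^sub>v (c - (1 / (a + \<mu>)) \<cdot>\<^sub>v (D *\<^sub>v c))"
    have "D *\<^sub>v x = (1 / a) \<cdot>\<^sub>v (D *\<^sub>v c - (1 / (a + \<mu>)) \<cdot>\<^sub>v (\<mu> \<cdot>\<^sub>v (D *\<^sub>v c)))"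
      unfolding eq using D c Dc
      by (simp add: mult_minus_distrib_mat_vec[OF D] mult_mat_vec[OF D] DD)
    \<comment> \<open>The required equation entry by entry, with u and v standing for entries of c
      and D c. The two contributions of v cancel.\<close>
    moreover have "a * (1 / a * (u - 1 / (a + \<mu>) * v)) + 1 / a * (v - 1 / (a + \<mu>) * (\<mu> * v)) = u"
      for u v
    proof -
      have "v - 1 / (a + \<mu>) * (\<mu> * v) = a * (1 / (a + \<mu>) * v)"
        using a by (simp add: field_simps)
      then show ?thesis
        using a by simp
    qed
    ultimately show "a \<cdot>\<^sub>v x + D *\<^sub>v x = c"
      using D c Dc
      by (intro eq_vecI) (simp_all add: eq del: index_mult_mat_vec)
  qed
qed

section \<open>Left multiplication by diagonal matrices\<close>

lemma index_diag_unit_mat_mult: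
  fixes Y :: "'a :: semiring_1 mat"
  assumes "Y \<in> carrier_mat n N" "p < n" "q < N"
  shows "(diag_unit_mat n i * Y) $$ (p, q) = (if p + 1 = i then Y $$ (p, q) else 0)"
proof -
  have "(diag_unit_mat n i * Y) $$ (p, q) = (\<Sum>k<n. diag_unit_mat n i $$ (p, k) * Y $$ (k, q))"
    using assms by (simp add: diag_unit_mat_def scalar_prod_def lessThan_atLeast0)
  \<comment> \<open>Only k = p can contribute, and only if row p is the selected one; p counts from
    0 and i from 1.\<close>
  also have "\<dots> = (\<Sum>k<n. if k = p then (if p + 1 = i then Y $$ (p, q) else 0) else 0)"
    using assms by (intro sum.cong) (auto simp: diag_unit_mat_def)
  finally show ?thesis
    using assms by simp
qed

lemma index_diagonal_mat_mult:
  fixes Y :: "'a :: semiring_1 mat"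
  assumes "A \<in> carrier_mat n n" "diagonal_mat A" "Y \<in> carrier_mat n N" "p < n" "q < N"
  shows "(A * Y) $$ (p, q) = A $$ (p, p) * Y $$ (p, q)"
proof -
  have "(A * Y) $$ (p, q) = (\<Sum>k<n. A $$ (p, k) * Y $$ (k, q))"
    using assms by (simp add: scalar_prod_def lessThan_atLeast0)
  also have "\<dots> = (\<Sum>k<n. if k = p then A $$ (p, p) * Y $$ (p, q) else 0)"
    using assms by (intro sum.cong) (auto simp: diagonal_mat_def)
  finally show ?thesis
    using assms by simp
qed

section \<open>Decoupling the matrix equation into rows\<close>

theorem corollary6p3:
  fixes n m :: nat
    and A B C :: "complex mat"
    and a :: "nat \<Rightarrow> complex"
    and h :: complex
    and As Bs :: "nat \<Rightarrow> complex mat"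
  assumes "n > 0" and "m > 0"
    and "A \<in> carrier_mat n n" and "diagonal_mat A"
    and "\<forall>k\<in>{1..n}. A $$ (k - 1, k - 1) = a k"
    and "B = h \<cdot>\<^sub>m all_ones_mat m"
    and "\<not> (\<exists>k\<in>{1..n}. a k = 0 \<or> a k = - of_nat m * h)"
    and "As 1 = A"
    and "\<forall>i\<in>{1..n}. As (i + 1) = diag_unit_mat n i"
    and "Bs 1 = kronecker_pow (1\<^sub>m m) n"
    and "\<forall>r\<in>{2..n + 1}. Bs r =
      transpose_mat (kronecker_pow (1\<^sub>m m) (r - 2) \<otimes>\<^sub>K B \<otimes>\<^sub>K kronecker_pow (1\<^sub>m m) (n + 1 - r))"
    and "C \<in> carrier_mat n (m ^ n)"
  shows "\<exists>!X. X \<in> carrier_mat n (m ^ n) \<and>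
    finsum_mat TYPE(complex) n (m ^ n) (\<lambda>i. As i * X * Bs i) {1..n + 1} = C"
proof -
  define N where "N = m ^ n"
  \<comment> \<open>With rows counted from 0, row p belongs to the summand r = p + 2, so the
    exponents r - 2 and n + 1 - r become p and n - 1 - p. The transpose is left out here.\<close>
  define D where "D p = kronecker_pow (1\<^sub>m m) p \<otimes>\<^sub>K B \<otimes>\<^sub>K kronecker_pow (1\<^sub>m m) (n - 1 - p)" for p
  define \<mu> where "\<mu> = of_nat m * h"
  define S where "S X = finsum_mat TYPE(complex) n N (\<lambda>i. As i * X * Bs i) {1..n + 1}" for X
  note A = assms(3)
  have C: "C \<in> carrier_mat n N"
    using assms(12) by (simp add: N_def)
  have B: "B \<in> carrier_mat m m"
    by (simp add: assms(6) all_ones_mat_def)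
  \<comment> \<open>The square of the all-ones matrix is m times itself, which is where \<mu> = m h
    comes from.\<close>
  have BB: "B * B = \<mu> \<cdot>\<^sub>m B"
    by (rule eq_matI) (auto simp: assms(6) all_ones_mat_def scalar_prod_def \<mu>_def)
  have D: "D p \<in> carrier_mat N N" if "p < n" for p
  proof -
    have "D p \<in> carrier_mat (m ^ p * m * m ^ (n - 1 - p)) (m ^ p * m * m ^ (n - 1 - p))"
      unfolding D_def kronecker_pow_one using B by (intro kronecker_mat_carrier) auto
    moreover have "m ^ p * m * m ^ (n - 1 - p) = m ^ (Suc p + (n - 1 - p))"
      unfolding power_add by simp
    ultimately show ?thesis
      using that by (simp add: N_def)
  qed
  have DD: "D p * D p = \<mu> \<cdot>\<^sub>m D p" for p
    unfolding D_def kronecker_pow_one by (rule kronecker_one_mat_one_square[OF B BB])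
  have Bs1: "Bs 1 = 1\<^sub>m N"
    unfolding assms(10) kronecker_pow_one N_def ..
  have Bs: "Bs (p + 2) = transpose_mat (D p)" if "p < n" for p
    using that bspec[OF assms(11), of "p + 2"] by (simp add: D_def)
  have As: "As (p + 2) = diag_unit_mat n (p + 1)" if "p < n" for p
    using that bspec[OF assms(9), of "p + 1"] by simp
  have As_carrier: "As i \<in> carrier_mat n n" and Bs_carrier: "Bs i \<in> carrier_mat N N"
    if i: "i \<in> {1..n + 1}" for i
  proof -
    have "i = 1 \<or> (\<exists>p<n. i = p + 2)"
      using i by (auto intro: exI[of _ "i - 2"])
    then consider "i = 1" | p where "p < n" "i = p + 2"
      by blast
    then have "As i \<in> carrier_mat n n \<and> Bs i \<in> carrier_mat N N"
    proof cases
      case 1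
      show ?thesis
        unfolding 1 Bs1 assms(8) using A by auto
    next
      case 2
      show ?thesis
        unfolding 2(2) As[OF 2(1)] Bs[OF 2(1)] using D[OF 2(1)] by (auto simp: diag_unit_mat_def)
    qed
    then show "As i \<in> carrier_mat n n" "Bs i \<in> carrier_mat N N"
      by auto
  qed
  have row_C: "row C p \<in> carrier_vec N" for p
    using C by auto
  have a: "A $$ (p, p) \<noteq> 0" "A $$ (p, p) + \<mu> \<noteq> 0" if "p < n" for p
  proof -
    have "p + 1 \<in> {1..n}"
      using that by simp
    then have "A $$ (p, p) = a (p + 1)" "a (p + 1) \<noteq> 0" "a (p + 1) \<noteq> - of_nat m * h"
      using bspec[OF assms(5), of "p + 1"] assms(7) by auto
    then show "A $$ (p, p) \<noteq> 0" "A $$ (p, p) + \<mu> \<noteq> 0"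
      by (auto simp: \<mu>_def add_eq_0_iff2)
  qed
  have summands: "(\<lambda>i. As i * X * Bs i) \<in> {1..n + 1} \<rightarrow> carrier_mat n N"
    if "X \<in> carrier_mat n N" for X
    by (intro funcsetI mult_carrier_mat[OF mult_carrier_mat[OF As_carrier that] Bs_carrier])
  have S_carrier: "S X \<in> carrier_mat n N" if "X \<in> carrier_mat n N" for X
    unfolding S_def by (rule finsum_mat_closed[OF summands[OF that]])
  \<comment> \<open>Row p of the sum sees only two summands: i = 1 scales it by the diagonal entry
    of A, and i = p + 2 is the only other one whose left factor keeps row p.\<close>
  have row_S: "row (S X) p = A $$ (p, p) \<cdot>\<^sub>v row X p + D p *\<^sub>v row X p"
    if X: "X \<in> carrier_mat n N" and p: "p < n" for X p
  proof (rule eq_vecI)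
    fix q
    assume "q < dim_vec (A $$ (p, p) \<cdot>\<^sub>v row X p + D p *\<^sub>v row X p)"
    then have q: "q < N"
      using D[OF p] by simp
    have XB: "X * Bs i \<in> carrier_mat n N" if "i \<in> {1..n + 1}" for i
      using X Bs_carrier[OF that] by simp
    \<comment> \<open>Reassociated so that the row-selecting factor acts on \<open>X * Bs i\<close>
      as a whole.\<close>
    have assoc: "As i * X * Bs i = As i * (X * Bs i)" if "i \<in> {1..n + 1}" for i
      using X As_carrier[OF that] Bs_carrier[OF that] by simp
    have "S X $$ (p, q) = (\<Sum>i\<in>{1..n + 1}. (As i * X * Bs i) $$ (p, q))"
      unfolding S_def by (rule index_finsum_mat[OF _ p q summands[OF X]]) simp
    also have "\<dots> = (As 1 * X * Bs 1) $$ (p, q) + (\<Sum>i\<in>{2..n + 1}. (As i * X * Bs i) $$ (p, q))"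
      by (subst sum.atLeast_Suc_atMost) (auto simp: numeral_2_eq_2)
    also have "(As 1 * X * Bs 1) $$ (p, q) = A $$ (p, p) * X $$ (p, q)"
      unfolding Bs1 assms(8) using A X p q assms(4)
      by (simp add: right_mult_one_mat[of _ n N] index_diagonal_mat_mult del: index_mult_mat(1))
    also have "(\<Sum>i\<in>{2..n + 1}. (As i * X * Bs i) $$ (p, q)) =
        (\<Sum>i\<in>{2..n + 1}. if i = p + 2 then (X * Bs (p + 2)) $$ (p, q) else 0)"
    proof (rule sum.cong)
      fix i
      assume i: "i \<in> {2..n + 1}"
      then obtain r where r: "i = r + 2" "r < n"
        by (auto intro: that[of "i - 2"])
      show "(As i * X * Bs i) $$ (p, q) = (if i = p + 2 then (X * Bs (p + 2)) $$ (p, q) else 0)"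
        using assoc[of i] XB[of i] i p q r As[of r]
        by (simp add: index_diag_unit_mat_mult del: index_mult_mat(1))
    qed simp
    also have "\<dots> = (X * transpose_mat (D p)) $$ (p, q)"
      using p Bs[OF p] by simp
    \<comment> \<open>The transpose in \<open>Bs\<close> turns right multiplication of a row into
      the action of \<open>D p\<close> on that row read as a column vector.\<close>
    also have "\<dots> = (D p *\<^sub>v row X p) $ q"
      using D[OF p] X p q by (simp add: scalar_prod_def ac_simps)
    finally show "row (S X) p $ q = (A $$ (p, p) \<cdot>\<^sub>v row X p + D p *\<^sub>v row X p) $ q"
      using S_carrier[OF X] X D[OF p] p q by simp
  qed (use S_carrier[OF X] D[OF p] in simp)
  define y where
    "y p = (1 / A $$ (p, p)) \<cdot>\<^sub>v (row C p - (1 / (A $$ (p, p) + \<mu>)) \<cdot>\<^sub>v (D p *\<^sub>v row C p))" for p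
  have y: "y p \<in> carrier_vec N" if "p < n" for p
    using D[OF that] row_C by (auto simp: y_def)
  have eq_iff_rows: "X = Y \<longleftrightarrow> (\<forall>p<n. row X p = row Y p)"
    if "X \<in> carrier_mat n N" "Y \<in> carrier_mat n N" for X Y :: "complex mat"
    using that by (auto intro!: eq_rowI)
  \<comment> \<open>Each row system is solved by an equivalence, so this one statement supplies both
    existence and uniqueness.\<close>
  have solution_iff: "S X = C \<longleftrightarrow> (\<forall>p<n. row X p = y p)" if X: "X \<in> carrier_mat n N" for X
  proof -
    have "row (S X) p = row C p \<longleftrightarrow> row X p = y p" if p: "p < n" for p
      unfolding row_S[OF X p] y_def
      by (rule shifted_quasi_idempotent_solve[OF D[OF p] DD a[OF p] _ row_C]) (use X in auto)
    then show ?thesis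
      using eq_iff_rows[OF S_carrier[OF X] C] by simp
  qed
  \<comment> \<open>The solution is assembled by stacking the row solutions
    \<open>y p\<close>.\<close>
  define X where "X = mat n N (\<lambda>(p, q). y p $ q)"
  have X: "X \<in> carrier_mat n N"
    by (simp add: X_def)
  have row_X: "row X p = y p" if "p < n" for p
    using that y[OF that] by (auto simp: X_def intro!: eq_vecI)
  have "\<exists>!X. X \<in> carrier_mat n N \<and> S X = C"
  proof (rule ex1I[of _ X])
    show "X \<in> carrier_mat n N \<and> S X = C"
      using X row_X by (simp add: solution_iff)
    show "Y = X" if "Y \<in> carrier_mat n N \<and> S Y = C" for Y
      using that X row_X solution_iff[of Y] by (simp add: eq_iff_rows)
  qed
  then show ?thesis
    by (simp add: S_def N_def)
qed

end
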